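(* Let $n_0\ge 2$ be a fixed integer and consider $n=Tn_0$ with $n\to\infty$, so that $T\to\infty$. For each such $n$ let $\{(\mathbf{x}_i,y_i)\}_{i=1}^n$ be generated by the $k$-sample linear regression model described in the context, where $n_0$ divides every sample size $n_j$, and the predictor, the intercept and the error are mutually independent. Assume that the $\mathbf{x}_i$ are i.i.d. (copies of $\mathbf{x}$) with $\mathbb{E}[\|\mathbf{x}\|^3]<\infty$ and that $\bm{\Sigma}_{\mathbf{xx}}=\mathrm{Var}(\mathbf{x})$ is positive definite. Then the EM estimator is consistent for $\bm{\beta}$: $$\hat{\bm{\beta}}_{\mathrm{EM}}\xrightarrow{P}\bm{\beta}\quad\text{as } n\to\infty.$$
   Context: Model. The observations satisfy $y_i=\mathbf{x}_i^{\top}\bm{\beta}+\nu_i+\varepsilon_i$, $i=1,\dots,n$, with $\bm{\beta}\in\mathbb{R}^p$, predictors $\mathbf{x}_i\in\mathbb{R}^p$ having distribution $F_{\mathbf{x}}$, and the pairs $(\mathbf{x}_i,y_i)$ independent across $i$. The data consist of $k$ consecutive samples (groups), the $j$th of size $n_j$, with $\sum_{j=1}^k n_j=n$. For every index $i$ in the $j$th sample, $\nu_i=c_j$ (a one-point distribution), with $c_j\in[\underline{\mu},\overline{\mu}]$, $\underline{\mu}=\min_{1\le j\le k} c_j$, $\overline{\mu}=\max_{1\le j\le k} c_j$, and $\varepsilon_i\sim\mathcal{N}(0,\sigma_j^2)$ with $\sigma_j\in[\underline{\sigma},\overline{\sigma}]$, $0<\underline{\sigma}\le\overline{\sigma}<\infty$.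 For each $i$, $\mathbf{x}_i,\nu_i,\varepsilon_i$ are mutually independent. As $n\to\infty$, the quantities $p$, $\bm{\beta}$, $F_{\mathbf{x}}$, $\underline{\mu},\overline{\mu},\underline{\sigma},\overline{\sigma}$ are fixed, while $k$, $n_j$, $c_j$, $\sigma_j$ may depend on $n$. Windows. The window size $n_0$ satisfies $n_0<\min_{1\le j\le k} n_j$, and $T=n/n_0$. The $j$th window is the index set $\{1+(j-1)n_0,\dots,jn_0\}$, $1\le j\le T$. Put $\bar{\mathbf{x}}_j=\frac1{n_0}\sum_{i=1+(j-1)n_0}^{jn_0}\mathbf{x}_i$ and $$\mathbf{W}=\sum_{j=1}^{T}\sum_{i=1+(j-1)n_0}^{jn_0}(\mathbf{x}_i-\bar{\mathbf{x}}_j)(\mathbf{x}_i-\bar{\mathbf{x}}_j)^{\top}.$$ EM estimator. The algorithm alternates: (E-step) given $\bm{\beta}^{(s)}$, set $a_j=\frac1{n_0}\sum_{i=1+(j-1)n_0}^{jn_0}(y_i-\mathbf{x}_i^{\top}\bm{\beta}^{(s)})$ and $\nu_i^{(s+1)}=a_j$ for all $i$ in window $j$; (M-step) let $\bm{\beta}^{(s+1)}$ minimize $\sum_{i=1}^n\{y_i-(\mathbf{x}_i^{\top}\bm{\beta}+\nu_i^{(s+1)})\}^2$ over $\bm{\beta}$, i.e. solve $\sum_{i=1}^n\{y_i-(\mathbf{x}_i^{\top}\bm{\beta}^{(s+1)}+\nu_i^{(s+1)})\}\mathbf{x}_i=\mathbf{0}$. The EM estimator $\hat{\bm{\beta}}_{\mathrm{EM}}$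 is the value upon convergence, i.e. the vector which together with numbers $\hat a_1,\dots,\hat a_T$ satisfies both $$\sum_{i=1+(j-1)n_0}^{jn_0}(y_i-\hat a_j-\mathbf{x}_i^{\top}\hat{\bm{\beta}}_{\mathrm{EM}})=0\ (1\le j\le T),\qquad \sum_{j=1}^T\sum_{i=1+(j-1)n_0}^{jn_0}(y_i-\hat a_j-\mathbf{x}_i^{\top}\hat{\bm{\beta}}_{\mathrm{EM}})\mathbf{x}_i=\mathbf{0}.$$ It is uniquely determined when $\mathbf{W}$ is invertible; on the event that $\mathbf{W}$ is singular it is given an arbitrary (measurable) value. *)

theory Defs
  imports "HOL-Probability.Probability"
begin

text \<open>The sample spaces may vary along the sequence; only the limit is fixed.\<close>

definition converges_in_probability ::
    "(nat \<Rightarrow> 'a measure) \<Rightarrow> (nat \<Rightarrow> 'a \<Rightarrow> 'b::metric_space) \<Rightarrow> 'b \<Rightarrow> bool" where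
  "converges_in_probability M X b \<longleftrightarrow>
     (\<forall>e>0. (\<lambda>m. measure (M m) {\<omega> \<in> space (M m). dist (X m \<omega>) b > e}) \<longlonglongrightarrow> 0)"

definition outer :: "real^'p \<Rightarrow> real^'p \<Rightarrow> real^'p^'p" where
  "outer u v = (\<chi> r s. u $ r * v $ s)"

definition positive_definite :: "real^'p^'p \<Rightarrow> bool" where
  "positive_definite A \<longleftrightarrow> transpose A = A \<and> (\<forall>v. v \<noteq> 0 \<longrightarrow> v \<bullet> (A *v v) > 0)"

definition covariance_matrix :: "(real^'p) measure \<Rightarrow> real^'p^'p" where
  "covariance_matrix F =
     (let \<mu> = (\<integral>z. z \<partial>F) in \<chi> r s. \<integral>z. outer (z - \<mu>) (z - \<mu>) $ r $ s \<partial>F)"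

text \<open>Observations, samples and windows are all numbered from 1.\<close>

definition sample_indices :: "(nat \<Rightarrow> nat) \<Rightarrow> nat \<Rightarrow> nat set" where
  "sample_indices ns j = {1 + (\<Sum>l=1..<j. ns l) .. (\<Sum>l=1..j. ns l)}"

definition window :: "nat \<Rightarrow> nat \<Rightarrow> nat set" where
  "window n0 j = {1 + (j - 1) * n0 .. j * n0}"

definition window_mean :: "nat \<Rightarrow> (nat \<Rightarrow> real^'p) \<Rightarrow> nat \<Rightarrow> real^'p" where
  "window_mean n0 x j = (1 / real n0) *\<^sub>R (\<Sum>i\<in>window n0 j. x i)"

definition within_window_scatter :: "nat \<Rightarrow> nat \<Rightarrow> (nat \<Rightarrow> real^'p) \<Rightarrow> real^'p^'p" where
  "within_window_scatter n0 T x =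
     (\<Sum>j=1..T. \<Sum>i\<in>window n0 j. outer (x i - window_mean n0 x j) (x i - window_mean n0 x j))"

text \<open>The equations satisfied by the limit of the EM iteration on one realization
  of the data: \<open>a\<close> is a fixed point of the E-step and \<open>b\<close> one of the M-step.\<close>

definition em_solution ::
    "nat \<Rightarrow> nat \<Rightarrow> (nat \<Rightarrow> real^'p) \<Rightarrow> (nat \<Rightarrow> real) \<Rightarrow> real^'p \<Rightarrow> bool" where
  "em_solution n0 T x y b \<longleftrightarrow> (\<exists>a :: nat \<Rightarrow> real.
     (\<forall>j\<in>{1..T}. (\<Sum>i\<in>window n0 j. y i - a j - x i \<bullet> b) = 0) \<and>
     (\<Sum>j=1..T. \<Sum>i\<in>window n0 j. (y i - a j - x i \<bullet> b) *\<^sub>R x i) = 0)"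

text \<open>An EM estimator is a random vector solving these equations wherever the
  scatter matrix is invertible; elsewhere its value is arbitrary.\<close>

definition em_estimator ::
    "'a measure \<Rightarrow> nat \<Rightarrow> nat \<Rightarrow> (nat \<Rightarrow> 'a \<Rightarrow> real^'p) \<Rightarrow> (nat \<Rightarrow> 'a \<Rightarrow> real) \<Rightarrow> ('a \<Rightarrow> real^'p) \<Rightarrow> bool" where
  "em_estimator M n0 T x y bhat \<longleftrightarrow>
     bhat \<in> borel_measurable M \<and>
     (\<forall>\<omega>\<in>space M. invertible (within_window_scatter n0 T (\<lambda>i. x i \<omega>)) \<longrightarrow>
        em_solution n0 T (\<lambda>i. x i \<omega>) (\<lambda>i. y i \<omega>) (bhat \<omega>))"

text \<open>Independence of random variables with different value types is not covered by
  \<open>indep_vars\<close>, so it is expressed through the generated \<open>\<sigma>\<close>-algebras.\<close>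

datatype component = Predictor | Intercept | Error

definition generated_events :: "'a measure \<Rightarrow> ('a \<Rightarrow> 'b::topological_space) \<Rightarrow> 'a set set" where
  "generated_events M X = {X -` A \<inter> space M | A. A \<in> sets borel}"

locale k_sample_regression = prob_space M
  for M :: "'a measure"
    and n k :: nat
    and ns :: "nat \<Rightarrow> nat"
    and c \<sigma> :: "nat \<Rightarrow> real"
    and \<mu>lo \<mu>hi \<sigma>lo \<sigma>hi :: real
    and F :: "(real^'p) measure"
    and \<beta> :: "real^'p"
    and x :: "nat \<Rightarrow> 'a \<Rightarrow> real^'p"
    and \<nu> \<epsilon> y :: "nat \<Rightarrow> 'a \<Rightarrow> real" +
  assumes groups_nonempty: "k \<ge> 1" "\<And>j. j \<in> {1..k} \<Longrightarrow> ns j \<ge> 1"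
    and sample_sizes: "(\<Sum>j=1..k. ns j) = n"
    and intercept_range: "\<mu>lo = Min (c ` {1..k})" "\<mu>hi = Max (c ` {1..k})"
    and sigma_bounds: "0 < \<sigma>lo" "\<sigma>lo \<le> \<sigma>hi"
    and sigma_range: "\<And>j. j \<in> {1..k} \<Longrightarrow> \<sigma> j \<in> {\<sigma>lo..\<sigma>hi}"
    and predictor_measurable: "\<And>i. i \<in> {1..n} \<Longrightarrow> x i \<in> borel_measurable M"
    and predictor_distr: "\<And>i. i \<in> {1..n} \<Longrightarrow> distr M borel (x i) = F"
    and intercept_measurable: "\<And>i. i \<in> {1..n} \<Longrightarrow> \<nu> i \<in> borel_measurable M"
    and intercept_distr: "\<And>i j. j \<in> {1..k} \<Longrightarrow> i \<in> sample_indices ns j \<Longrightarrow>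
           distr M borel (\<nu> i) = return borel (c j)"
    and error_distr: "\<And>i j. j \<in> {1..k} \<Longrightarrow> i \<in> sample_indices ns j \<Longrightarrow>
           distributed M lborel (\<epsilon> i) (\<lambda>e. ennreal (normal_density 0 (\<sigma> j) e))"
    and components_indep: "\<And>i. i \<in> {1..n} \<Longrightarrow>
           indep_sets (\<lambda>q. case q of Predictor \<Rightarrow> generated_events M (x i)
                                   | Intercept \<Rightarrow> generated_events M (\<nu> i)
                                   | Error \<Rightarrow> generated_events M (\<epsilon> i)) UNIV"
    and regression: "\<And>i \<omega>. i \<in> {1..n} \<Longrightarrow> \<omega> \<in> space M \<Longrightarrow>
           y i \<omega> = x i \<omega> \<bullet> \<beta> + \<nu> i \<omega> + \<epsilon> i \<omega>"
    and pairs_indep: "indep_vars (\<lambda>_. borel) (\<lambda>i \<omega>. (x i \<omega>, y i \<omega>)) {1..n}"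

end

theory Submission
  imports Defs
begin

text \<open>
  Within a window the intercept is constant, since the window size divides every sample size.
  Centring each window therefore removes the intercepts, and the EM equations reduce to
  \<open>W (b - \<beta>) = \<Sum> (e i - mean of e over the window of i) x i\<close>, where \<open>W\<close> is the
  within-window scatter matrix and \<open>e\<close> the error (\<open>em_solution_error_identity\<close>). It
  remains to see that, with high probability, \<open>W\<close> grows linearly in the number
  \<open>T\<close> of windows while the right-hand
  side is of smaller order.

  For \<open>W\<close> a lower bound suffices. Up to a factor two its quadratic form dominates that of
  the sum over windows of \<open>d d\<^sup>T\<close>, with \<open>d\<close> the difference of the first two
  predictors of the window. Entries of \<open>d d\<^sup>T\<close> need not have a finite variance, so the
  matrices are first divided by \<open>1 + |d|\<^sup>2\<close>: this decreases the form
  (\<open>within_window_scatter_ge_damped\<close>), makes the entries bounded, and still leaves a positive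
  definite mean (\<open>damped_spread_positive\<close>). Chebyshev's inequality then keeps the average
  over windows close to this mean (\<open>damped_spread_deviation\<close>).

  The right-hand side is a combination, with a number of terms depending only on \<open>n0\<close>, of
  sums over windows of products \<open>x e\<close> taken at fixed positions in the window
  (\<open>noise_term_bound\<close>). For fixed positions the products are independent, centred and have
  bounded second moments, so Chebyshev's inequality applies again (\<open>noise_deviation\<close>).
  Altogether the probability of an error above \<open>\<delta>\<close> is at most a constant divided by
  \<open>T\<close> (\<open>estimation_error_probability\<close>).
\<close>

section \<open>A quantitative weak law of large numbers\<close>

text \<open>Independence makes the cross terms vanish, so second moments of centred variables add.\<close>

lemma (in prob_space) second_moment_sum_le:
  fixes Z :: "'i \<Rightarrow> 'a \<Rightarrow> real"
  assumes "finite I"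
    and "indep_vars (\<lambda>_. borel) Z I"
    and "\<And>i. i \<in> I \<Longrightarrow> integrable M (\<lambda>\<omega>. (Z i \<omega>)\<^sup>2)"
    and "\<And>i. i \<in> I \<Longrightarrow> expectation (Z i) = 0"
    and "\<And>i. i \<in> I \<Longrightarrow> expectation (\<lambda>\<omega>. (Z i \<omega>)\<^sup>2) \<le> C"
  shows "integrable M (\<lambda>\<omega>. (\<Sum>i\<in>I. Z i \<omega>)\<^sup>2)
    \<and> expectation (\<lambda>\<omega>. (\<Sum>i\<in>I. Z i \<omega>)\<^sup>2) \<le> real (card I) * C"
  using assms
proof (induction I rule: finite_induct)
  case empty
  then show ?case by simp
next
  case (insert i I)
  have rv [measurable]: "\<And>k. k \<in> insert i I \<Longrightarrow> Z k \<in> borel_measurable M"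
    using insert.prems(1) by (auto simp: indep_vars_def)
  let ?S = "\<lambda>\<omega>. \<Sum>k\<in>I. Z k \<omega>"
  have Zi: "integrable M (Z k)" if "k \<in> insert i I" for k
    by (rule square_integrable_imp_integrable[OF rv[OF that] insert.prems(2)[OF that]])
  have IH: "integrable M (\<lambda>\<omega>. (?S \<omega>)\<^sup>2)" "expectation (\<lambda>\<omega>. (?S \<omega>)\<^sup>2) \<le> real (card I) * C"
    using insert.IH insert.prems indep_vars_subset[OF insert.prems(1), of I] by auto
  have S: "integrable M ?S" "expectation ?S = 0"
    using Zi insert.prems(3) by (auto simp: Bochner_Integration.integral_sum)
  have ind: "indep_var borel (Z i) borel ?S"
    by (rule indep_vars_sum[OF insert.hyps insert.prems(1)])
  have cross: "integrable M (\<lambda>\<omega>. Z i \<omega> * ?S \<omega>)" "expectation (\<lambda>\<omega>. Z i \<omega> * ?S \<omega>) = 0"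
    using indep_var_integrable[OF ind Zi S(1)] indep_var_lebesgue_integral[OF ind Zi S(1)] S(2)
    by auto
  have eq: "(\<Sum>k\<in>insert i I. Z k \<omega>)\<^sup>2 = (Z i \<omega>)\<^sup>2 + 2 * (Z i \<omega> * ?S \<omega>) + (?S \<omega>)\<^sup>2" for \<omega>
    using insert.hyps by (simp add: power2_sum algebra_simps)
  have int: "integrable M (\<lambda>\<omega>. (Z i \<omega>)\<^sup>2)" using insert.prems(2) by simp
  have "expectation (\<lambda>\<omega>. (\<Sum>k\<in>insert i I. Z k \<omega>)\<^sup>2)
      = expectation (\<lambda>\<omega>. (Z i \<omega>)\<^sup>2) + expectation (\<lambda>\<omega>. (?S \<omega>)\<^sup>2)"
    unfolding eq using int cross IH(1) by simp
  also have "\<dots> \<le> C + real (card I) * C"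
    using insert.prems(4) IH(2) by (intro add_mono) auto
  also have "\<dots> = real (card (insert i I)) * C"
    using insert.hyps by (simp add: algebra_simps)
  finally show ?case
    unfolding eq using int cross IH(1) by (auto simp: eq)
qed

text \<open>Chebyshev's inequality, with the variance of each summand bounded by its second moment.
  The bound involves no limit and no fixed probability space, so it applies along a
  sequence of models whose sample spaces change.\<close>

lemma (in prob_space) weak_law_bound:
  fixes Z :: "'i \<Rightarrow> 'a \<Rightarrow> real"
  assumes fin: "finite I" and ne: "I \<noteq> {}"
    and ind: "indep_vars (\<lambda>_. borel) Z I"
    and sq: "\<And>i. i \<in> I \<Longrightarrow> integrable M (\<lambda>\<omega>. (Z i \<omega>)\<^sup>2)"
    and mean: "\<And>i. i \<in> I \<Longrightarrow> expectation (Z i) = \<mu>"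
    and bnd: "\<And>i. i \<in> I \<Longrightarrow> expectation (\<lambda>\<omega>. (Z i \<omega>)\<^sup>2) \<le> C"
    and \<delta>: "\<delta> > 0"
  shows "prob {\<omega> \<in> space M. \<bar>(\<Sum>i\<in>I. Z i \<omega>) - real (card I) * \<mu>\<bar> \<ge> real (card I) * \<delta>}
    \<le> C / (real (card I) * \<delta>\<^sup>2)"
proof -
  have rv [measurable]: "\<And>k. k \<in> I \<Longrightarrow> Z k \<in> borel_measurable M"
    using ind by (auto simp: indep_vars_def)
  have Zi: "integrable M (Z k)" if "k \<in> I" for k
    by (rule square_integrable_imp_integrable[OF rv[OF that] sq[OF that]])
  let ?Y = "\<lambda>i \<omega>. Z i \<omega> - \<mu>"
  have sqe: "(?Y i \<omega>)\<^sup>2 = (Z i \<omega>)\<^sup>2 - 2 * \<mu> * Z i \<omega> + \<mu>\<^sup>2" for i \<omega>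
    by (simp add: power2_eq_square algebra_simps)
  have Ysq: "integrable M (\<lambda>\<omega>. (?Y i \<omega>)\<^sup>2)" if "i \<in> I" for i
    unfolding sqe using sq[OF that] Zi[OF that] by simp
  have Yb: "expectation (\<lambda>\<omega>. (?Y i \<omega>)\<^sup>2) \<le> C" if "i \<in> I" for i
  proof -
    have "expectation (\<lambda>\<omega>. (?Y i \<omega>)\<^sup>2) = expectation (\<lambda>\<omega>. (Z i \<omega>)\<^sup>2) - \<mu>\<^sup>2"
      unfolding sqe using sq[OF that] Zi[OF that] mean[OF that]
      by (simp add: prob_space power2_eq_square)
    then show ?thesis using bnd[OF that] by (smt (verit) zero_le_power2)
  qed
  have Y0: "expectation (?Y i) = 0" if "i \<in> I" for i
    using Zi[OF that] mean[OF that] by (simp add: prob_space)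
  have iY: "indep_vars (\<lambda>_. borel) ?Y I"
    by (rule indep_vars_compose2[OF ind, where Y="\<lambda>_ z. z - \<mu>"]) auto
  let ?S = "\<lambda>\<omega>. \<Sum>i\<in>I. ?Y i \<omega>"
  have S: "integrable M (\<lambda>\<omega>. (?S \<omega>)\<^sup>2)" "expectation (\<lambda>\<omega>. (?S \<omega>)\<^sup>2) \<le> real (card I) * C"
    using second_moment_sum_le[OF fin iY Ysq Y0 Yb] by auto
  have ES: "expectation ?S = 0"
    using Y0 Zi by (simp add: Bochner_Integration.integral_sum)
  have c: "real (card I) > 0" using fin ne by (simp add: card_gt_0_iff)
  have [measurable]: "?S \<in> borel_measurable M" by measurable
  have "prob {\<omega> \<in> space M. \<bar>?S \<omega> - expectation ?S\<bar> \<ge> real (card I) * \<delta>}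
      \<le> variance ?S / (real (card I) * \<delta>)\<^sup>2"
    using c \<delta> S(1) by (intro Chebyshev_inequality) auto
  also have "\<dots> \<le> (real (card I) * C) / (real (card I) * \<delta>)\<^sup>2"
    using S(2) ES by (intro divide_right_mono) auto
  also have "\<dots> = C / (real (card I) * \<delta>\<^sup>2)"
    using c \<delta> by (simp add: power2_eq_square)
  finally show ?thesis
    unfolding ES by (simp add: sum_subtractf)
qed

section \<open>The damped spread of two independent predictors\<close>

lemma fst_borel_measurable [measurable]:
    "fst \<in> borel_measurable (borel :: ('b::topological_space \<times> 'c::topological_space) measure)"
  and snd_borel_measurable [measurable]:
    "snd \<in> borel_measurable (borel :: ('b::topological_space \<times> 'c::topological_space) measure)"
  by (auto intro!: borel_measurable_continuous_onI continuous_intros)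

lemma component_measurable [measurable (raw)]:
  fixes f :: "'a \<Rightarrow> real^'p"
  assumes "f \<in> borel_measurable N"
  shows "(\<lambda>\<omega>. f \<omega> $ r) \<in> borel_measurable N"
proof -
  have "(\<lambda>z :: real^'p. z $ r) \<in> borel_measurable borel"
    by (intro borel_measurable_continuous_onI continuous_intros)
  from measurable_compose[OF assms this] show ?thesis .
qed

text \<open>The entries of the matrix \<open>d d\<^sup>T / (1 + |d|\<^sup>2)\<close>. The division makes them
  bounded, so Chebyshev's inequality applies to their averages although \<open>d d\<^sup>T\<close> itself
  may have infinite variance under a third-moment assumption. It only shrinks the quadratic
  form of \<open>d d\<^sup>T\<close>, so lower bounds survive, and it leaves its kernel unchanged.\<close>

definition damped_product :: "'p \<Rightarrow> 'p \<Rightarrow> real^'p \<Rightarrow> real" where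
  "damped_product r s d = d $ r * d $ s / (1 + (norm d)\<^sup>2)"

lemma damped_product_measurable [measurable]: "damped_product r s \<in> borel_measurable borel"
  unfolding damped_product_def[abs_def] by measurable

lemma abs_damped_product_le_1: "\<bar>damped_product r s d\<bar> \<le> 1"
proof -
  have "\<bar>d $ r\<bar> * \<bar>d $ s\<bar> \<le> norm d * norm d"
    by (intro mult_mono component_le_norm_cart) auto
  then show ?thesis
    by (simp add: damped_product_def abs_mult power2_eq_square add_pos_nonneg divide_le_eq)
qed

lemma quadratic_form_damped_product:
  fixes v d :: "real^'p"
  shows "(\<Sum>r\<in>UNIV. \<Sum>s\<in>UNIV. v $ r * v $ s * damped_product r s d) = (d \<bullet> v)\<^sup>2 / (1 + (norm d)\<^sup>2)"
proof -
  have "(\<Sum>r\<in>UNIV. \<Sum>s\<in>UNIV. v $ r * v $ s * damped_product r s d)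
      = (\<Sum>r\<in>UNIV. \<Sum>s\<in>UNIV. (d $ r * v $ r) * (d $ s * v $ s)) / (1 + (norm d)\<^sup>2)"
    by (simp add: damped_product_def sum_divide_distrib mult_ac)
  also have "(\<Sum>r\<in>UNIV. \<Sum>s\<in>UNIV. (d $ r * v $ r) * (d $ s * v $ s)) = (d \<bullet> v)\<^sup>2"
    by (simp add: power2_eq_square inner_vec_def sum_product)
  finally show ?thesis .
qed

text \<open>The mean of the damped matrix when \<open>d\<close> is the difference of two independent draws
  from \<open>F\<close>; without the damping it would be twice the covariance matrix.\<close>

definition damped_spread :: "(real^'p) measure \<Rightarrow> 'p \<Rightarrow> 'p \<Rightarrow> real" where
  "damped_spread F r s = (\<integral>(z, w). damped_product r s (z - w) \<partial>(F \<Otimes>\<^sub>M F))"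

lemma quadratic_form_covariance_matrix:
  fixes F :: "(real^'p) measure"
  assumes "prob_space F" "sets F = sets borel" and sq: "integrable F (\<lambda>z. (norm z)\<^sup>2)"
  shows "v \<bullet> (covariance_matrix F *v v) = (\<integral>z. (v \<bullet> z - v \<bullet> (\<integral>z. z \<partial>F))\<^sup>2 \<partial>F)"
proof -
  interpret F: prob_space F by fact
  have [measurable_cong]: "sets F = sets borel" by fact
  define m where "m = (\<integral>z. z \<partial>F)"
  have int1: "integrable F (\<lambda>z. (norm (z - m))\<^sup>2)"
  proof (rule Bochner_Integration.integrable_bound)
    show "integrable F (\<lambda>z. 2 * (norm z)\<^sup>2 + 2 * (norm m)\<^sup>2)" using sq by simp
    show "AE z in F. norm ((norm (z - m))\<^sup>2) \<le> norm (2 * (norm z)\<^sup>2 + 2 * (norm m)\<^sup>2)"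
    proof (rule AE_I2)
      fix z
      have "(norm (z - m))\<^sup>2 \<le> (norm z + norm m)\<^sup>2"
        by (intro power_mono norm_triangle_ineq4) auto
      also have "\<dots> \<le> 2 * (norm z)\<^sup>2 + 2 * (norm m)\<^sup>2"
        using sum_squares_bound[of "norm z" "norm m"] by (simp add: power2_sum)
      finally show "norm ((norm (z - m))\<^sup>2) \<le> norm (2 * (norm z)\<^sup>2 + 2 * (norm m)\<^sup>2)"
        by simp
    qed
  qed simp
  have int2: "integrable F (\<lambda>z. (z - m) $ r * (z - m) $ s)" for r s
  proof (rule Bochner_Integration.integrable_bound[OF int1])
    show "AE z in F. norm ((z - m) $ r * (z - m) $ s) \<le> norm ((norm (z - m))\<^sup>2)"
      unfolding power2_eq_square real_norm_def abs_mult
      by (intro AE_I2 mult_mono) (auto simp: component_le_norm_cart simp del: vector_minus_component)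
  qed simp
  have "v \<bullet> (covariance_matrix F *v v)
      = (\<Sum>r\<in>UNIV. \<Sum>s\<in>UNIV. v $ r * v $ s * (\<integral>z. (z - m) $ r * (z - m) $ s \<partial>F))"
    unfolding covariance_matrix_def Let_def m_def[symmetric]
    by (simp add: inner_vec_def matrix_vector_mult_def outer_def sum_distrib_left mult_ac)
  also have "\<dots> = (\<integral>z. (\<Sum>r\<in>UNIV. \<Sum>s\<in>UNIV. v $ r * v $ s * ((z - m) $ r * (z - m) $ s)) \<partial>F)"
    using int2 by (simp add: Bochner_Integration.integral_sum del: vector_minus_component)
  also have "\<dots> = (\<integral>z. (v \<bullet> z - v \<bullet> m)\<^sup>2 \<partial>F)"
    unfolding inner_diff_right[symmetric]
    by (simp add: power2_eq_square inner_vec_def sum_product mult_ac)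
  finally show ?thesis unfolding m_def .
qed

text \<open>If the form vanished at \<open>v\<close>, two independent draws would almost surely have
  the same inner product with \<open>v\<close>. By Fubini that inner product would then be almost surely
  constant, and the variance in direction \<open>v\<close> would be zero.\<close>

lemma damped_spread_positive:
  fixes F :: "(real^'p) measure"
  assumes F: "prob_space F" "sets F = sets borel" and sq: "integrable F (\<lambda>z. (norm z)\<^sup>2)"
    and pd: "positive_definite (covariance_matrix F)" and v: "v \<noteq> 0"
  shows "(\<Sum>r\<in>UNIV. \<Sum>s\<in>UNIV. v $ r * v $ s * damped_spread F r s) > 0"
proof -
  interpret F: prob_space F by fact
  interpret FF: pair_prob_space F F ..
  have [measurable_cong]: "sets F = sets borel" by fact
  let ?q = "\<lambda>(z, w). ((z - w) \<bullet> v)\<^sup>2 / (1 + (norm (z - w))\<^sup>2)"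
  have int: "integrable (F \<Otimes>\<^sub>M F) (\<lambda>(z, w). damped_product r s (z - w))" for r s
    by (rule FF.P.integrable_const_bound[of _ 1]) (auto simp: abs_damped_product_le_1 split_beta)
  have form: "?q p = (\<Sum>r\<in>UNIV. \<Sum>s\<in>UNIV. v $ r * v $ s * (case p of (z, w) \<Rightarrow> damped_product r s (z - w)))" for p
    by (cases p) (simp add: quadratic_form_damped_product)
  have qint: "integrable (F \<Otimes>\<^sub>M F) ?q"
    unfolding form using int by auto
  have eq: "(\<Sum>r\<in>UNIV. \<Sum>s\<in>UNIV. v $ r * v $ s * damped_spread F r s) = integral\<^sup>L (F \<Otimes>\<^sub>M F) ?q"
    unfolding form damped_spread_def using int by (simp add: Bochner_Integration.integral_sum)
  have nn: "0 \<le> ?q p" for p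
    by (cases p) auto
  have "integral\<^sup>L (F \<Otimes>\<^sub>M F) ?q \<noteq> 0"
  proof
    assume "integral\<^sup>L (F \<Otimes>\<^sub>M F) ?q = 0"
    then have "AE p in F \<Otimes>\<^sub>M F. ?q p = 0"
      using integral_nonneg_eq_0_iff_AE[OF qint] nn by auto
    then have "AE p in F \<Otimes>\<^sub>M F. fst p \<bullet> v = snd p \<bullet> v"
    proof eventually_elim
      case (elim p)
      have "1 + (norm (fst p - snd p))\<^sup>2 > 0" by (simp add: add_pos_nonneg)
      then show ?case using elim by (auto simp: split_beta inner_diff_left)
    qed
    then have "AE z in F. AE w in F. z \<bullet> v = w \<bullet> v"
      using FF.AE_pair by fastforce
    then obtain z where z: "AE w in F. z \<bullet> v = w \<bullet> v"
      by (metis (mono_tags, lifting) F.AE_False eventually_elim2 eventually_mono)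
    let ?m = "\<integral>z. z \<partial>F"
    have intid: "integrable F (\<lambda>z. z)"
    proof (rule Bochner_Integration.integrable_bound)
      show "integrable F (\<lambda>z. 1 + (norm z)\<^sup>2)" using sq by simp
      have "t \<le> 1 + t\<^sup>2" for t :: real
        using sum_squares_bound[of t 1] zero_le_power2[of t]
        unfolding power_one mult_1_right by linarith
      then show "AE z in F. norm z \<le> norm (1 + (norm z)\<^sup>2)" by auto
    qed simp
    have "v \<bullet> ?m = (\<integral>w. v \<bullet> w \<partial>F)" using intid by simp
    also have "\<dots> = (\<integral>w. z \<bullet> v \<partial>F)"
      using z by (intro integral_cong_AE) (auto simp: inner_commute elim: eventually_mono)
    also have "\<dots> = z \<bullet> v" by (simp add: F.prob_space)
    finally have vm: "v \<bullet> ?m = z \<bullet> v" .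
    have "(\<integral>w. (v \<bullet> w - v \<bullet> ?m)\<^sup>2 \<partial>F) = (\<integral>w. 0 \<partial>F)"
      unfolding vm using z
      by (intro integral_cong_AE) (auto simp: inner_commute elim: eventually_mono)
    then have "v \<bullet> (covariance_matrix F *v v) = 0"
      using quadratic_form_covariance_matrix[OF F sq] by simp
    then show False using pd v by (auto simp: positive_definite_def)
  qed
  moreover have "integral\<^sup>L (F \<Otimes>\<^sub>M F) ?q \<ge> 0" by (intro integral_nonneg_AE) (use nn in auto)
  ultimately show ?thesis unfolding eq by linarith
qed

text \<open>The form attains a positive minimum on the compact unit sphere; homogeneity does the rest.\<close>

lemma positive_quadratic_form_coercive:
  fixes h :: "'p::finite \<Rightarrow> 'p \<Rightarrow> real"
  assumes pos: "\<And>v::real^'p. v \<noteq> 0 \<Longrightarrow> (\<Sum>r\<in>UNIV. \<Sum>s\<in>UNIV. v $ r * v $ s * h r s) > 0"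
  obtains \<kappa> where "\<kappa> > 0"
    "\<And>v::real^'p. (\<Sum>r\<in>UNIV. \<Sum>s\<in>UNIV. v $ r * v $ s * h r s) \<ge> \<kappa> * (norm v)\<^sup>2"
proof -
  let ?q = "\<lambda>v::real^'p. \<Sum>r\<in>UNIV. \<Sum>s\<in>UNIV. v $ r * v $ s * h r s"
  let ?S = "sphere (0 :: real^'p) 1"
  have "compact ?S" "?S \<noteq> {}" "continuous_on ?S ?q"
    by (auto intro!: continuous_intros)
  then obtain u where u: "u \<in> ?S" "\<And>v. v \<in> ?S \<Longrightarrow> ?q u \<le> ?q v"
    using continuous_attains_inf[of ?S ?q] by blast
  show ?thesis
  proof
    show "?q u > 0" using u(1) by (intro pos) auto
    fix v :: "real^'p"
    show "?q v \<ge> ?q u * (norm v)\<^sup>2"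
    proof (cases "v = 0")
      case False
      define w where "w = (1 / norm v) *\<^sub>R v"
      have "w \<in> ?S" and vw: "norm v * w $ r = v $ r" for r using False by (auto simp: w_def)
      have "(norm v)\<^sup>2 * ?q w
          = (\<Sum>r\<in>UNIV. \<Sum>s\<in>UNIV. (norm v * w $ r) * (norm v * w $ s) * h r s)"
        by (simp add: power2_eq_square sum_distrib_left mult_ac)
      then have "?q v = (norm v)\<^sup>2 * ?q w" by (simp only: vw)
      then show ?thesis using u(2)[OF \<open>w \<in> ?S\<close>]
        by (simp add: mult.commute mult_left_mono)
    qed simp
  qed
qed

lemma quadratic_form_perturbation:
  fixes v :: "real^'p"
  assumes "\<And>r s. \<bar>g r s - h r s\<bar> \<le> \<delta>"
  shows "(\<Sum>r\<in>UNIV. \<Sum>s\<in>UNIV. v $ r * v $ s * g r s)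
    \<ge> (\<Sum>r\<in>UNIV. \<Sum>s\<in>UNIV. v $ r * v $ s * h r s) - (real CARD('p))\<^sup>2 * \<delta> * (norm v)\<^sup>2"
proof -
  have "(\<Sum>r\<in>UNIV. \<Sum>s\<in>UNIV. v $ r * v $ s * h r s) - (\<Sum>r\<in>UNIV. \<Sum>s\<in>UNIV. v $ r * v $ s * g r s)
      = (\<Sum>r\<in>UNIV. \<Sum>s\<in>UNIV. v $ r * v $ s * (h r s - g r s))"
    by (simp add: sum_subtractf right_diff_distrib)
  also have "\<dots> \<le> (\<Sum>r::'p\<in>UNIV. \<Sum>s::'p\<in>UNIV. norm v * norm v * \<delta>)"
  proof (intro sum_mono)
    fix r s
    have "v $ r * v $ s * (h r s - g r s) \<le> \<bar>v $ r\<bar> * \<bar>v $ s\<bar> * \<bar>g r s - h r s\<bar>"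
      by (metis abs_ge_self abs_minus_commute abs_mult)
    also have "\<dots> \<le> norm v * norm v * \<delta>"
      using assms by (intro mult_mono component_le_norm_cart) auto
    finally show "v $ r * v $ s * (h r s - g r s) \<le> norm v * norm v * \<delta>" .
  qed
  also have "\<dots> = (real CARD('p))\<^sup>2 * \<delta> * (norm v)\<^sup>2"
    by (simp add: power2_eq_square)
  finally show ?thesis by linarith
qed

section \<open>Windows and their scatter matrix\<close>

lemma sum_window:
  assumes "j \<ge> 1"
  shows "(\<Sum>i\<in>window n0 j. f i) = (\<Sum>a=1..n0. f ((j - 1) * n0 + a))"
proof (rule sum.reindex_bij_betw[symmetric])
  have *: "j * n0 = (j - 1) * n0 + n0"
    using assms by (cases j) auto
  show "bij_betw ((+) ((j - 1) * n0)) {1..n0} (window n0 j)"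
    unfolding window_def *
    by (rule bij_betw_byWitness[where f'="\<lambda>i. i - (j - 1) * n0"]) auto
qed

lemma window_index:
  assumes "j \<ge> 1" "a \<in> {1..n0}"
  shows "(j - 1) * n0 + a \<in> window n0 j"
proof -
  have "j * n0 = (j - 1) * n0 + n0"
    using assms by (cases j) auto
  then show ?thesis using assms by (auto simp: window_def)
qed

lemma window_subset:
  assumes "j \<in> {1..T}"
  shows "window n0 j \<subseteq> {1..T * n0}"
  using assms mult_le_mono1[of j T n0] by (auto simp: window_def)

lemma disjoint_windows: "disjoint_family_on (window n0) {1..T}"
proof -
  have *: "window n0 i \<inter> window n0 j = {}" if "i < j" for i j
  proof -
    have "i * n0 \<le> (j - 1) * n0" using that by (intro mult_le_mono1) auto
    then have False if "q \<in> window n0 i" "q \<in> window n0 j" for q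
      using that unfolding window_def atLeastAtMost_iff by linarith
    then show ?thesis by blast
  qed
  then show ?thesis
    unfolding disjoint_family_on_def by (metis inf_commute nat_neq_iff)
qed

text \<open>All partial sums of the sample sizes are multiples of \<open>n0\<close>, so no sample boundary
  falls strictly inside a window.\<close>

lemma window_within_sample:
  assumes dvd: "\<And>s. s \<in> {1..k} \<Longrightarrow> n0 dvd ns s"
    and size: "(\<Sum>s=1..k. ns s) = T * n0" and j: "j \<in> {1..T}" and n0: "n0 > 0"
  shows "\<exists>s\<in>{1..k}. window n0 j \<subseteq> sample_indices ns s"
proof -
  let ?N = "\<lambda>s. \<Sum>l=1..s. ns l"
  (* The first sample that reaches the end of the window contains all of it. *)
  define s where "s = (LEAST s. j * n0 \<le> ?N s)"
  have ex: "j * n0 \<le> ?N k" using size j by simp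
  have s: "j * n0 \<le> ?N s" unfolding s_def by (rule LeastI[of _ k]) (rule ex)
  have sk: "s \<le> k" unfolding s_def by (rule Least_le) (rule ex)
  have s1: "s \<ge> 1" using s j n0 by (cases s) auto
  have "\<not> j * n0 \<le> ?N (s - 1)"
    unfolding s_def by (rule not_less_Least) (use s1 in \<open>simp add: s_def\<close>)
  moreover have "n0 dvd ?N (s - 1)" using sk s1 by (intro dvd_sum dvd) auto
  then obtain q where q: "?N (s - 1) = n0 * q" by (rule dvdE)
  ultimately have "n0 * q < n0 * j" by (simp add: mult.commute)
  then have "q \<le> j - 1" by auto
  then have "?N (s - 1) \<le> (j - 1) * n0" using q by (simp add: mult.commute)
  moreover have "{1..<s} = {1..s - 1}" using s1 by auto
  ultimately have "window n0 j \<subseteq> sample_indices ns s"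
    using s by (auto simp: window_def sample_indices_def)
  then show ?thesis using sk s1 by auto
qed

lemma quadratic_form_within_window_scatter:
  fixes x :: "nat \<Rightarrow> real^'p"
  shows "v \<bullet> (within_window_scatter n0 T x *v v)
    = (\<Sum>j=1..T. \<Sum>i\<in>window n0 j. (x i \<bullet> v - window_mean n0 x j \<bullet> v)\<^sup>2)"
proof -
  have outer: "v \<bullet> (outer u u *v v) = (u \<bullet> v)\<^sup>2" for u :: "real^'p"
  proof -
    have "outer u u *v v = (u \<bullet> v) *\<^sub>R u"
      by (simp add: vec_eq_iff matrix_vector_mult_def outer_def inner_vec_def sum_distrib_left mult_ac)
    then show ?thesis by (simp add: power2_eq_square inner_commute)
  qed
  have sum: "v \<bullet> (sum A I *v v) = (\<Sum>i\<in>I. v \<bullet> (A i *v v))" for A :: "nat \<Rightarrow> real^'p^'p" and I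
    by (induction I rule: infinite_finite_induct)
       (auto simp: matrix_vector_mult_add_rdistrib inner_add_right)
  show ?thesis
    unfolding within_window_scatter_def sum outer by (simp add: inner_diff_left)
qed

text \<open>Only the first two observations of each window are kept: whatever the centre \<open>m\<close>,
  \<open>(a - m)\<^sup>2 + (b - m)\<^sup>2 \<ge> (a - b)\<^sup>2 / 2\<close>. This replaces the window means
  by differences of two independent predictors, and here \<open>n0 \<ge> 2\<close> enters.\<close>

lemma within_window_scatter_ge_damped:
  fixes x :: "nat \<Rightarrow> real^'p"
  assumes n0: "n0 \<ge> 2"
  shows "2 * (v \<bullet> (within_window_scatter n0 T x *v v))
    \<ge> (\<Sum>r\<in>UNIV. \<Sum>s\<in>UNIV. v $ r * v $ s *
         (\<Sum>j=1..T. damped_product r s (x ((j - 1) * n0 + 1) - x ((j - 1) * n0 + 2))))"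
proof -
  let ?d = "\<lambda>j. x ((j - 1) * n0 + 1) - x ((j - 1) * n0 + 2)"
  have "(\<Sum>r\<in>UNIV. \<Sum>s\<in>UNIV. v $ r * v $ s * (\<Sum>j=1..T. damped_product r s (?d j)))
      = (\<Sum>j=1..T. \<Sum>r\<in>UNIV. \<Sum>s\<in>UNIV. v $ r * v $ s * damped_product r s (?d j))"
  proof -
    have "(\<Sum>r\<in>UNIV. \<Sum>s\<in>UNIV. v $ r * v $ s * (\<Sum>j=1..T. damped_product r s (?d j)))
      = (\<Sum>r\<in>UNIV. \<Sum>j=1..T. \<Sum>s\<in>UNIV. v $ r * v $ s * damped_product r s (?d j))"
      unfolding sum_distrib_left by (intro sum.cong refl sum.swap)
    also have "\<dots> = (\<Sum>j=1..T. \<Sum>r\<in>UNIV. \<Sum>s\<in>UNIV. v $ r * v $ s * damped_product r s (?d j))"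
      by (rule sum.swap)
    finally show ?thesis .
  qed
  also have "\<dots> = (\<Sum>j=1..T. (?d j \<bullet> v)\<^sup>2 / (1 + (norm (?d j))\<^sup>2))"
    by (simp add: quadratic_form_damped_product)
  also have "\<dots> \<le> (\<Sum>j=1..T. 2 * (\<Sum>i\<in>window n0 j. (x i \<bullet> v - window_mean n0 x j \<bullet> v)\<^sup>2))"
  proof (rule sum_mono)
    fix j assume j: "j \<in> {1..T}"
    let ?m = "window_mean n0 x j \<bullet> v"
    let ?i = "(j - 1) * n0 + 1" and ?i' = "(j - 1) * n0 + 2"
    have "(?d j \<bullet> v)\<^sup>2 / (1 + (norm (?d j))\<^sup>2) \<le> (?d j \<bullet> v)\<^sup>2"
      by (simp add: divide_le_eq add_pos_nonneg mult_le_cancel_left1)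
    also have "\<dots> = ((x ?i \<bullet> v - ?m) - (x ?i' \<bullet> v - ?m))\<^sup>2"
      by (simp add: inner_diff_left)
    also have "\<dots> \<le> 2 * ((x ?i \<bullet> v - ?m)\<^sup>2 + (x ?i' \<bullet> v - ?m)\<^sup>2)"
    proof -
      have "(a - b)\<^sup>2 \<le> 2 * (a\<^sup>2 + b\<^sup>2)" for a b :: real
        using zero_le_power2[of "a + b"] by (simp add: power2_sum power2_diff)
      then show ?thesis .
    qed
    also have "(x ?i \<bullet> v - ?m)\<^sup>2 + (x ?i' \<bullet> v - ?m)\<^sup>2 = (\<Sum>i\<in>{?i, ?i'}. (x i \<bullet> v - ?m)\<^sup>2)"
      by simp
    also have "\<dots> \<le> (\<Sum>i\<in>window n0 j. (x i \<bullet> v - ?m)\<^sup>2)"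
      using window_index[of j 1 n0] window_index[of j 2 n0] n0 j
      by (intro sum_mono2) (auto simp: window_def)
    finally show "(?d j \<bullet> v)\<^sup>2 / (1 + (norm (?d j))\<^sup>2)
        \<le> 2 * (\<Sum>i\<in>window n0 j. (x i \<bullet> v - ?m)\<^sup>2)" by simp
  qed
  also have "\<dots> = 2 * (v \<bullet> (within_window_scatter n0 T x *v v))"
    by (simp add: quadratic_form_within_window_scatter sum_distrib_left)
  finally show ?thesis .
qed

section \<open>The error of an EM fixed point\<close>

text \<open>The first family of equations determines the window intercepts as means of the
  residuals, which removes the unknown constants \<open>d j\<close>. Substituted into the last equation
  they give \<open>W (b - \<beta>) = \<Sum> (e i - mean of e) x i\<close>; only its inner product with
  \<open>b - \<beta>\<close> is needed, and this form is available even when \<open>W\<close> is singular.\<close>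

lemma em_solution_error_identity:
  fixes x :: "nat \<Rightarrow> real^'p"
  assumes n0: "n0 > 0"
    and model: "\<And>j i. j \<in> {1..T} \<Longrightarrow> i \<in> window n0 j \<Longrightarrow> y i = x i \<bullet> \<beta> + d j + e i"
    and sol: "em_solution n0 T x y b"
  shows "(b - \<beta>) \<bullet> (within_window_scatter n0 T x *v (b - \<beta>))
    = (\<Sum>j=1..T. \<Sum>i\<in>window n0 j. (e i - (\<Sum>l\<in>window n0 j. e l) / real n0) * (x i \<bullet> (b - \<beta>)))"
proof -
  define v where "v = b - \<beta>"
  obtain a where a1: "\<And>j. j \<in> {1..T} \<Longrightarrow> (\<Sum>i\<in>window n0 j. y i - a j - x i \<bullet> b) = 0"
    and a2: "(\<Sum>j=1..T. \<Sum>i\<in>window n0 j. (y i - a j - x i \<bullet> b) *\<^sub>R x i) = 0"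
    using sol unfolding em_solution_def by blast
  have card: "real (card (window n0 j)) = real n0" if "j \<in> {1..T}" for j
    using that sum_window[of j "\<lambda>_. 1::nat" n0] by simp
  let ?m = "\<lambda>j. window_mean n0 x j \<bullet> v" and ?e = "\<lambda>j. (\<Sum>l\<in>window n0 j. e l) / real n0"
  have mean: "(\<Sum>i\<in>window n0 j. x i \<bullet> v) = real n0 * ?m j" for j
    using n0 by (simp add: window_mean_def inner_sum_left)
  have res: "y i - a j - x i \<bullet> b = (e i - ?e j) - (x i \<bullet> v - ?m j)"
    if j: "j \<in> {1..T}" and i: "i \<in> window n0 j" for i j
  proof -
    have *: "y i - a j - x i \<bullet> b = (d j - a j) + e i - x i \<bullet> v" if "i \<in> window n0 j" for i
      using model[OF j that] by (simp add: v_def inner_diff_right)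
    have "0 = (\<Sum>i\<in>window n0 j. (d j - a j) + e i - x i \<bullet> v)"
      using a1[OF j] * by simp
    also have "\<dots> = real n0 * (d j - a j) + real n0 * ?e j - real n0 * ?m j"
      using card[OF j] mean[of j] n0 by (simp add: sum.distrib sum_subtractf)
    finally have "real n0 * (d j - a j + ?e j - ?m j) = 0" by (simp only: ring_distribs)
    then have "d j - a j = ?m j - ?e j" using n0 by simp
    then show ?thesis using *[OF i] by simp
  qed
  have "0 = (\<Sum>j=1..T. \<Sum>i\<in>window n0 j. (y i - a j - x i \<bullet> b) *\<^sub>R x i) \<bullet> v"
    using a2 by simp
  also have "\<dots> = (\<Sum>j=1..T. \<Sum>i\<in>window n0 j. ((e i - ?e j) - (x i \<bullet> v - ?m j)) * (x i \<bullet> v))"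
    by (simp add: inner_sum_left res)
  also have "\<dots> = (\<Sum>j=1..T. (\<Sum>i\<in>window n0 j. (e i - ?e j) * (x i \<bullet> v))
                 - (\<Sum>i\<in>window n0 j. (x i \<bullet> v - ?m j)\<^sup>2))"
  proof (rule sum.cong[OF refl])
    fix j assume j: "j \<in> {1..T}"
    have "(\<Sum>i\<in>window n0 j. (x i \<bullet> v - ?m j) * ?m j) = 0"
      using mean[of j] card[OF j] by (simp add: sum_subtractf flip: sum_distrib_right)
    moreover have "((e i - ?e j) - (x i \<bullet> v - ?m j)) * (x i \<bullet> v)
        = (e i - ?e j) * (x i \<bullet> v) - (x i \<bullet> v - ?m j)\<^sup>2 - (x i \<bullet> v - ?m j) * ?m j" for i
      by (simp add: power2_eq_square algebra_simps)
    ultimately show "(\<Sum>i\<in>window n0 j. ((e i - ?e j) - (x i \<bullet> v - ?m j)) * (x i \<bullet> v))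
        = (\<Sum>i\<in>window n0 j. (e i - ?e j) * (x i \<bullet> v)) - (\<Sum>i\<in>window n0 j. (x i \<bullet> v - ?m j)\<^sup>2)"
      by (simp only: sum_subtractf)
  qed
  also have "\<dots> = (\<Sum>j=1..T. \<Sum>i\<in>window n0 j. (e i - ?e j) * (x i \<bullet> v))
      - v \<bullet> (within_window_scatter n0 T x *v v)"
    by (simp add: sum_subtractf quadratic_form_within_window_scatter)
  finally show ?thesis by (simp add: v_def)
qed

text \<open>Expanding the window mean of \<open>e\<close> turns the noise term into a combination of
  sums over windows of \<open>x e\<close> at fixed offsets \<open>a\<close>, \<open>b\<close> inside the window.
  For fixed offsets the summands belong to different windows, hence are independent.\<close>

lemma noise_term_bound:
  fixes x :: "nat \<Rightarrow> real^'p"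
  assumes n0: "n0 > 0"
    and Q: "\<And>a b r. a \<in> {1..n0} \<Longrightarrow> b \<in> {1..n0} \<Longrightarrow>
        \<bar>\<Sum>j=1..T. x ((j - 1) * n0 + a) $ r * e ((j - 1) * n0 + b)\<bar> \<le> B"
  shows "(\<Sum>j=1..T. \<Sum>i\<in>window n0 j. (e i - (\<Sum>l\<in>window n0 j. e l) / real n0) * (x i \<bullet> v))
    \<le> 2 * real n0 * real CARD('p) * B * norm v"
proof -
  let ?x = "\<lambda>j a. x ((j - 1) * n0 + a)" and ?e = "\<lambda>j b. e ((j - 1) * n0 + b)"
  define R where "R a b = (\<Sum>j=1..T. ?e j b * (?x j a \<bullet> v))" for a b
  have R: "\<bar>R a b\<bar> \<le> real CARD('p) * B * norm v" if "a \<in> {1..n0}" "b \<in> {1..n0}" for a b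
  proof -
    have "R a b = (\<Sum>r\<in>UNIV. v $ r * (\<Sum>j=1..T. ?x j a $ r * ?e j b))"
      unfolding R_def inner_vec_def sum_distrib_left by (subst sum.swap) (simp add: mult_ac)
    also have "\<bar>\<dots>\<bar> \<le> (\<Sum>r::'p\<in>UNIV. norm v * B)"
      using Q[OF that] by (intro sum_abs[THEN order_trans] sum_mono)
        (auto simp: abs_mult intro!: mult_mono component_le_norm_cart)
    finally show ?thesis by (simp add: mult_ac)
  qed
  have "(\<Sum>i\<in>window n0 j. (e i - (\<Sum>l\<in>window n0 j. e l) / real n0) * (x i \<bullet> v))
      = (\<Sum>a=1..n0. ?e j a * (?x j a \<bullet> v)) - (\<Sum>a=1..n0. \<Sum>b=1..n0. ?e j b * (?x j a \<bullet> v)) / real n0"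
    if "j \<in> {1..T}" for j
    using that by (simp add: sum_window left_diff_distrib sum_subtractf sum_divide_distrib
        sum_distrib_right sum_distrib_left)
  then have "(\<Sum>j=1..T. \<Sum>i\<in>window n0 j. (e i - (\<Sum>l\<in>window n0 j. e l) / real n0) * (x i \<bullet> v))
      = (\<Sum>j=1..T. (\<Sum>a=1..n0. ?e j a * (?x j a \<bullet> v)))
        - (\<Sum>j=1..T. \<Sum>a=1..n0. \<Sum>b=1..n0. ?e j b * (?x j a \<bullet> v)) / real n0"
    by (simp add: sum_subtractf sum_divide_distrib)
  also have "(\<Sum>j=1..T. (\<Sum>a=1..n0. ?e j a * (?x j a \<bullet> v))) = (\<Sum>a=1..n0. R a a)"
    unfolding R_def by (rule sum.swap)
  also have "(\<Sum>j=1..T. \<Sum>a=1..n0. \<Sum>b=1..n0. ?e j b * (?x j a \<bullet> v)) = (\<Sum>a=1..n0. \<Sum>b=1..n0. R a b)"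
    unfolding R_def by (subst sum.swap, rule sum.cong[OF refl], rule sum.swap)
  also have "(\<Sum>a=1..n0. R a a) - (\<Sum>a=1..n0. \<Sum>b=1..n0. R a b) / real n0
      \<le> (\<Sum>a=1..n0. real CARD('p) * B * norm v)
        + (\<Sum>a=1..n0. \<Sum>b=1..n0. real CARD('p) * B * norm v) / real n0"
  proof -
    have "(\<Sum>a=1..n0. R a a) \<le> (\<Sum>a=1..n0. real CARD('p) * B * norm v)"
      using R by (intro sum_mono) (auto dest: abs_le_D1)
    moreover have "- (\<Sum>a=1..n0. \<Sum>b=1..n0. R a b) \<le> (\<Sum>a=1..n0. \<Sum>b=1..n0. real CARD('p) * B * norm v)"
      unfolding sum_negf[symmetric] using R by (intro sum_mono) (auto dest: abs_le_D2)
    then have "- (\<Sum>a=1..n0. \<Sum>b=1..n0. R a b) / real n0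
        \<le> (\<Sum>a=1..n0. \<Sum>b=1..n0. real CARD('p) * B * norm v) / real n0"
      by (rule divide_right_mono) simp
    ultimately show ?thesis by simp
  qed
  also have "\<dots> = 2 * real n0 * real CARD('p) * B * norm v"
    using n0 by (simp add: field_simps)
  finally show ?thesis .
qed

text \<open>The deterministic core. If the damped average is close to its mean \<open>h\<close>, then
  \<open>v \<bullet> W v \<ge> T \<kappa> |v|\<^sup>2 / 4\<close>, so \<open>W\<close> is invertible and the EM equations hold;
  comparing this at \<open>v = b - \<beta>\<close> with the bound on the noise term gives
  \<open>|v|\<^sup>2 \<le> \<delta> |v|\<close>. Half of \<open>\<kappa>\<close> is sacrificed to the deviation from
  \<open>h\<close> and another factor two comes from the comparison of the two forms; the two
  tolerances are chosen accordingly.\<close>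

lemma estimation_error_le:
  fixes x :: "nat \<Rightarrow> real^'p"
  assumes n0: "n0 \<ge> 2" and T: "T > 0" and \<kappa>: "\<kappa> > 0" and \<delta>: "\<delta> > 0"
    and coercive: "\<And>v::real^'p. (\<Sum>r\<in>UNIV. \<Sum>s\<in>UNIV. v $ r * v $ s * h r s) \<ge> \<kappa> * (norm v)\<^sup>2"
    and model: "\<And>j i. j \<in> {1..T} \<Longrightarrow> i \<in> window n0 j \<Longrightarrow> y i = x i \<bullet> \<beta> + d j + e i"
    and sol: "invertible (within_window_scatter n0 T x) \<Longrightarrow> em_solution n0 T x y b"
    and spread: "\<And>r s. \<bar>(\<Sum>j=1..T. damped_product r s (x ((j - 1) * n0 + 1) - x ((j - 1) * n0 + 2)))
        - real T * h r s\<bar> \<le> real T * (\<kappa> / (2 * (real CARD('p))\<^sup>2))"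
    and noise: "\<And>a b r. a \<in> {1..n0} \<Longrightarrow> b \<in> {1..n0} \<Longrightarrow>
        \<bar>\<Sum>j=1..T. x ((j - 1) * n0 + a) $ r * e ((j - 1) * n0 + b)\<bar>
        \<le> real T * (\<kappa> * \<delta> / (8 * real n0 * real CARD('p)))"
  shows "norm (b - \<beta>) \<le> \<delta>"
proof -
  let ?W = "within_window_scatter n0 T x" and ?p = "real CARD('p)"
  have p: "?p > 0" by simp
  have lower: "v \<bullet> (?W *v v) \<ge> real T * \<kappa> / 4 * (norm v)\<^sup>2" for v
  proof -
    let ?G = "\<lambda>r s. \<Sum>j=1..T. damped_product r s (x ((j - 1) * n0 + 1) - x ((j - 1) * n0 + 2))"
    let ?q = "\<lambda>g. \<Sum>r\<in>UNIV. \<Sum>s\<in>UNIV. v $ r * v $ s * g r s"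
    have "real T * (\<kappa> * (norm v)\<^sup>2) \<le> ?q (\<lambda>r s. real T * h r s)"
      using mult_left_mono[OF coercive[of v], of "real T"] by (simp add: sum_distrib_left mult_ac)
    moreover have "?q (\<lambda>r s. real T * h r s) - ?p\<^sup>2 * (real T * (\<kappa> / (2 * ?p\<^sup>2))) * (norm v)\<^sup>2 \<le> ?q ?G"
      by (rule quadratic_form_perturbation[OF spread])
    moreover have "?p\<^sup>2 * (real T * (\<kappa> / (2 * ?p\<^sup>2))) * (norm v)\<^sup>2 = real T * (\<kappa> * (norm v)\<^sup>2) / 2"
      using p by (simp add: field_simps)
    moreover have "?q ?G \<le> 2 * (v \<bullet> (?W *v v))"
      by (rule within_window_scatter_ge_damped[OF n0])
    ultimately have "real T * (\<kappa> * (norm v)\<^sup>2) / 4 \<le> v \<bullet> (?W *v v)" by linarith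
    then show ?thesis by (simp add: mult_ac)
  qed
  have "invertible ?W"
    unfolding invertible_left_inverse matrix_left_invertible_ker
  proof (intro allI impI)
    fix v assume "?W *v v = 0"
    then have "real T * \<kappa> / 4 * (norm v)\<^sup>2 \<le> 0" using lower[of v] by simp
    then show "v = 0" using T \<kappa> by (simp add: mult_le_0_iff)
  qed
  then have sol: "em_solution n0 T x y b" by (rule sol)
  define v where "v = b - \<beta>"
  have "real T * \<kappa> / 4 * (norm v)\<^sup>2 \<le> v \<bullet> (?W *v v)" by (rule lower)
  also have "\<dots> \<le> 2 * real n0 * ?p * (real T * (\<kappa> * \<delta> / (8 * real n0 * ?p))) * norm v"
  proof -
    have "n0 > 0" using n0 by simp
    have "v \<bullet> (?W *v v)
        = (\<Sum>j=1..T. \<Sum>i\<in>window n0 j. (e i - (\<Sum>l\<in>window n0 j. e l) / real n0) * (x i \<bullet> v))"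
      unfolding v_def by (rule em_solution_error_identity[OF \<open>n0 > 0\<close> model sol])
    also have "\<dots> \<le> 2 * real n0 * ?p * (real T * (\<kappa> * \<delta> / (8 * real n0 * ?p))) * norm v"
      by (rule noise_term_bound[OF \<open>n0 > 0\<close> noise])
    finally show ?thesis .
  qed
  also have "\<dots> = real T * \<kappa> / 4 * (\<delta> * norm v)"
    using p n0 by (simp add: field_simps)
  finally have "(norm v)\<^sup>2 \<le> \<delta> * norm v"
    using T \<kappa> by simp
  then show ?thesis
    using \<delta> unfolding v_def power2_eq_square by (cases "b = \<beta>") (auto simp: mult_le_cancel_right)
qed

section \<open>Deviation probabilities in the k-sample model\<close>

context k_sample_regression
begin

lemma pair_measurable: "i \<in> {1..n} \<Longrightarrow> (\<lambda>\<omega>. (x i \<omega>, y i \<omega>)) \<in> borel_measurable M"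
  using pairs_indep by (auto simp: indep_vars_def)

lemma response_measurable: "i \<in> {1..n} \<Longrightarrow> y i \<in> borel_measurable M"
  using measurable_compose[OF pair_measurable, of i snd borel] by (simp add: borel_measurable_continuous_onI continuous_on_snd)

text \<open>The pairs \<open>(x, y)\<close> are independent over observations, whereas nothing is said
  about the errors of different observations. Since the intercept is almost surely the
  constant \<open>c s\<close>, the error can be recovered as a function of the pair, and inherits the
  independence.\<close>

lemma residual_eq_error:
  assumes s: "s \<in> {1..k}" "i \<in> sample_indices ns s" and i: "i \<in> {1..n}"
  shows "AE \<omega> in M. y i \<omega> - x i \<omega> \<bullet> \<beta> - c s = \<epsilon> i \<omega>"
proof -
  have "AE t in return borel (c s). t = c s" by (subst AE_return) auto
  then have "AE t in distr M borel (\<nu> i). t = c s" by (simp only: intercept_distr[OF s])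
  then have "AE \<omega> in M. \<nu> i \<omega> = c s"
    by (subst (asm) AE_distr_iff) (use intercept_measurable[OF i] in auto)
  then show ?thesis using AE_space
    by eventually_elim (simp add: regression[OF i])
qed

lemma error_moments:
  assumes s: "s \<in> {1..k}" "i \<in> sample_indices ns s"
  shows "\<epsilon> i \<in> borel_measurable M"
    and "expectation (\<epsilon> i) = 0"
    and "integrable M (\<lambda>\<omega>. (\<epsilon> i \<omega>)\<^sup>2)"
    and "expectation (\<lambda>\<omega>. (\<epsilon> i \<omega>)\<^sup>2) \<le> \<sigma>hi\<^sup>2"
proof -
  have \<sigma>: "0 < \<sigma> s" "\<sigma> s \<le> \<sigma>hi" using sigma_range[OF s(1)] sigma_bounds by auto
  note D = error_distr[OF s]
  show "\<epsilon> i \<in> borel_measurable M"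
    using distributed_measurable[OF D] by simp
  show E: "expectation (\<epsilon> i) = 0" by (rule normal_distributed_expectation[OF \<sigma>(1) D])
  show "integrable M (\<lambda>\<omega>. (\<epsilon> i \<omega>)\<^sup>2)"
    using distributed_integrable[OF D, of "\<lambda>t. t\<^sup>2"] integrable_normal_moment[OF \<sigma>(1), of 0 2] by simp
  have "expectation (\<lambda>\<omega>. (\<epsilon> i \<omega>)\<^sup>2) = (\<sigma> s)\<^sup>2"
    using normal_distributed_variance[OF \<sigma>(1) D] E by simp
  then show "expectation (\<lambda>\<omega>. (\<epsilon> i \<omega>)\<^sup>2) \<le> \<sigma>hi\<^sup>2"
    using \<sigma> by (simp add: power_mono)
qed

text \<open>Stated for a component, because \<open>indep_var\<close> relates two variables with values in
  the same type.\<close>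

lemma predictor_indep_error:
  assumes i: "i \<in> {1..n}" and meas: "\<epsilon> i \<in> borel_measurable M"
  shows "indep_var borel (\<lambda>\<omega>. x i \<omega> $ r) borel (\<epsilon> i)"
proof -
  note [measurable] = predictor_measurable[OF i]
  let ?X = "\<lambda>\<omega>. x i \<omega> $ r"
  have X: "?X \<in> borel_measurable M" by measurable
  let ?F = "\<lambda>q. case q of Predictor \<Rightarrow> generated_events M (x i)
      | Intercept \<Rightarrow> generated_events M (\<nu> i) | Error \<Rightarrow> generated_events M (\<epsilon> i)"
  have ind: "indep_sets ?F UNIV" by (rule components_indep[OF i])
  have stable: "Int_stable (generated_events M X)" for X :: "'a \<Rightarrow> 'b::topological_space"
  proof (rule Int_stableI)
    fix A B assume "A \<in> generated_events M X" "B \<in> generated_events M X"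
    then obtain A' B' where "A' \<in> sets borel" "B' \<in> sets borel"
      "A = X -` A' \<inter> space M" "B = X -` B' \<inter> space M"
      by (auto simp: generated_events_def)
    then have "A \<inter> B = X -` (A' \<inter> B') \<inter> space M \<and> A' \<inter> B' \<in> sets borel" by auto
    then show "A \<inter> B \<in> generated_events M X" unfolding generated_events_def by blast
  qed
  have sub: "generated_events M ?X \<subseteq> generated_events M (x i)"
  proof
    fix A assume "A \<in> generated_events M ?X"
    then obtain A' where A': "A' \<in> sets borel" "A = ?X -` A' \<inter> space M"
      by (auto simp: generated_events_def)
    have "(\<lambda>z :: real^'p. z $ r) -` A' \<in> sets borel"
      using measurable_sets[OF _ A'(1), of "\<lambda>z :: real^'p. z $ r" borel] by simp
    moreover have "A = x i -` ((\<lambda>z. z $ r) -` A') \<inter> space M" using A'(2) by auto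
    ultimately show "A \<in> generated_events M (x i)" unfolding generated_events_def by blast
  qed
  have "indep_set (generated_events M ?X) (generated_events M (\<epsilon> i))"
    unfolding indep_sets2_eq
  proof (intro conjI ballI)
    show "generated_events M ?X \<subseteq> events"
      by (auto simp: generated_events_def intro: measurable_sets[OF X])
    show "generated_events M (\<epsilon> i) \<subseteq> events"
      using meas by (auto simp: generated_events_def measurable_sets)
    fix A B assume A: "A \<in> generated_events M ?X" and B: "B \<in> generated_events M (\<epsilon> i)"
    let ?E = "\<lambda>q. if q = Predictor then A else B"
    have "prob (\<Inter>q\<in>{Predictor, Error}. ?E q) = (\<Prod>q\<in>{Predictor, Error}. prob (?E q))"
      by (rule indep_setsD[OF ind]) (use A B sub in auto)
    then show "prob (A \<inter> B) = prob A * prob B" by (simp add: Int_commute)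
  qed
  from indep_set_sigma_sets[OF this stable stable]
  show ?thesis
    unfolding indep_var_eq using X meas by (simp add: generated_events_def)
qed

lemma pairs_indep_two:
  assumes "i \<in> {1..n}" "l \<in> {1..n}" "i \<noteq> l"
    and [measurable]: "f \<in> borel_measurable borel" "g \<in> borel_measurable borel"
  shows "indep_var borel (\<lambda>\<omega>. f (x i \<omega>, y i \<omega>)) borel (\<lambda>\<omega>. g (x l \<omega>, y l \<omega>))"
proof -
  have "indep_var (PiM {i} (\<lambda>_. borel)) (\<lambda>\<omega>. \<lambda>m\<in>{i}. (x m \<omega>, y m \<omega>))
     (PiM {l} (\<lambda>_. borel)) (\<lambda>\<omega>. \<lambda>m\<in>{l}. (x m \<omega>, y m \<omega>))"
    using assms by (intro indep_var_restrict[OF pairs_indep]) auto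
  from indep_var_compose[OF this, of "\<lambda>p. f (p i)" borel "\<lambda>p. g (p l)" borel]
  show ?thesis by (simp add: comp_def)
qed

text \<open>Predictor and residual are independent for two different reasons: for
  \<open>i \<noteq> l\<close> because they belong to different pairs, for \<open>i = l\<close> because the
  components of one observation are independent. In both cases the moments factorize.\<close>

lemma predictor_residual_moments:
  fixes r :: 'p
  assumes s: "s \<in> {1..k}" "l \<in> sample_indices ns s" and i: "i \<in> {1..n}" and l: "l \<in> {1..n}"
    and sq: "integrable F (\<lambda>z. (norm z)\<^sup>2)"
  defines "P \<equiv> \<lambda>\<omega>. x i \<omega> $ r * (y l \<omega> - x l \<omega> \<bullet> \<beta> - c s)"
  shows "expectation P = 0"
    and "integrable M (\<lambda>\<omega>. (P \<omega>)\<^sup>2)"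
    and "expectation (\<lambda>\<omega>. (P \<omega>)\<^sup>2) \<le> (\<integral>z. (norm z)\<^sup>2 \<partial>F) * \<sigma>hi\<^sup>2"
proof -
  let ?e = "\<lambda>\<omega>. y l \<omega> - x l \<omega> \<bullet> \<beta> - c s"
  note [measurable] = predictor_measurable[OF i] predictor_measurable[OF l] response_measurable[OF l]
  note err [measurable] = error_moments[OF s]
  have AE_e: "AE \<omega> in M. ?e \<omega> = \<epsilon> l \<omega>" by (rule residual_eq_error[OF s l])
  (* e' is the residual for i \<noteq> l and the error for i = l: only the error is known to be
     independent of the predictor of its own observation, and it agrees with the residual
     almost surely. *)
  obtain e' where e': "indep_var borel (\<lambda>\<omega>. x i \<omega> $ r) borel e'" "AE \<omega> in M. e' \<omega> = ?e \<omega>"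
    "AE \<omega> in M. e' \<omega> = \<epsilon> l \<omega>"
  proof (cases "i = l")
    case True
    then show ?thesis
      using predictor_indep_error[OF l err(1)] AE_e that[of "\<epsilon> l"] by (simp add: eq_commute)
  next
    case False
    have "indep_var borel (\<lambda>\<omega>. x i \<omega> $ r) borel ?e"
      using pairs_indep_two[OF i l False, of "\<lambda>p. fst p $ r" "\<lambda>p. snd p - fst p \<bullet> \<beta> - c s"] by simp
    then show ?thesis using that[of ?e] AE_e by simp
  qed
  have [measurable]: "e' \<in> borel_measurable M" using e'(1) by (rule indep_var_rv2)
  have e'sq: "integrable M (\<lambda>\<omega>. (e' \<omega>)\<^sup>2)"
    by (subst integrable_cong_AE[where g="\<lambda>\<omega>. (\<epsilon> l \<omega>)\<^sup>2"])
       (use e'(3) err(3) in \<open>auto elim: eventually_mono\<close>)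
  have e'Esq: "expectation (\<lambda>\<omega>. (e' \<omega>)\<^sup>2) \<le> \<sigma>hi\<^sup>2"
    by (subst integral_cong_AE[where g="\<lambda>\<omega>. (\<epsilon> l \<omega>)\<^sup>2"])
       (use e'(3) err(4) in \<open>auto elim: eventually_mono\<close>)
  have e'0: "expectation e' = 0"
    by (subst integral_cong_AE[where g="\<epsilon> l"]) (use e'(3) err(2) in auto)
  have e'int: "integrable M e'" by (rule square_integrable_imp_integrable[OF _ e'sq]) simp
  have nsq: "integrable M (\<lambda>\<omega>. (norm (x i \<omega>))\<^sup>2)"
    using sq unfolding predictor_distr[OF i, symmetric] by (subst (asm) integrable_distr_eq) auto
  have xsq: "integrable M (\<lambda>\<omega>. (x i \<omega> $ r)\<^sup>2)"
    by (rule Bochner_Integration.integrable_bound[OF nsq])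
       (auto simp: component_le_norm_cart abs_le_square_iff[symmetric])
  have xint: "integrable M (\<lambda>\<omega>. x i \<omega> $ r)"
    by (rule square_integrable_imp_integrable[OF _ xsq]) simp
  have xEsq: "expectation (\<lambda>\<omega>. (x i \<omega> $ r)\<^sup>2) \<le> (\<integral>z. (norm z)\<^sup>2 \<partial>F)"
  proof -
    have "expectation (\<lambda>\<omega>. (x i \<omega> $ r)\<^sup>2) \<le> expectation (\<lambda>\<omega>. (norm (x i \<omega>))\<^sup>2)"
      using xsq nsq by (intro integral_mono) (auto simp: component_le_norm_cart abs_le_square_iff[symmetric])
    also have "\<dots> = (\<integral>z. (norm z)\<^sup>2 \<partial>F)"
      unfolding predictor_distr[OF i, symmetric] by (subst integral_distr) auto
    finally show ?thesis .
  qed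
  have ind2: "indep_var borel (\<lambda>\<omega>. (x i \<omega> $ r)\<^sup>2) borel (\<lambda>\<omega>. (e' \<omega>)\<^sup>2)"
    using indep_var_compose[OF e'(1), of "\<lambda>z. z\<^sup>2" borel "\<lambda>z. z\<^sup>2" borel] by (simp add: comp_def)
  have AE_P: "AE \<omega> in M. P \<omega> = x i \<omega> $ r * e' \<omega>"
    using e'(2) unfolding P_def by eventually_elim simp
  then have AE_P2: "AE \<omega> in M. (P \<omega>)\<^sup>2 = (x i \<omega> $ r)\<^sup>2 * (e' \<omega>)\<^sup>2"
    by eventually_elim (simp add: power_mult_distrib)
  have [measurable]: "P \<in> borel_measurable M" unfolding P_def by measurable
  show "expectation P = 0"
    using indep_var_lebesgue_integral[OF e'(1) xint e'int] e'0 AE_P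
    by (subst integral_cong_AE[OF _ _ AE_P]) auto
  show "integrable M (\<lambda>\<omega>. (P \<omega>)\<^sup>2)"
    using indep_var_integrable[OF ind2 xsq e'sq]
    by (subst integrable_cong_AE[OF _ _ AE_P2]) auto
  have "expectation (\<lambda>\<omega>. (P \<omega>)\<^sup>2) = expectation (\<lambda>\<omega>. (x i \<omega> $ r)\<^sup>2) * expectation (\<lambda>\<omega>. (e' \<omega>)\<^sup>2)"
    using indep_var_lebesgue_integral[OF ind2 xsq e'sq]
    by (subst integral_cong_AE[OF _ _ AE_P2]) auto
  also have "\<dots> \<le> (\<integral>z. (norm z)\<^sup>2 \<partial>F) * \<sigma>hi\<^sup>2"
    by (intro mult_mono xEsq e'Esq) (auto intro!: integral_nonneg_AE)
  finally show "expectation (\<lambda>\<omega>. (P \<omega>)\<^sup>2) \<le> (\<integral>z. (norm z)\<^sup>2 \<partial>F) * \<sigma>hi\<^sup>2" .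
qed

lemma damped_product_expectation:
  assumes "i \<in> {1..n}" "l \<in> {1..n}" "i \<noteq> l"
  shows "expectation (\<lambda>\<omega>. damped_product r s (x i \<omega> - x l \<omega>)) = damped_spread F r s"
proof -
  note [measurable] = predictor_measurable[OF assms(1)] predictor_measurable[OF assms(2)]
  have "indep_var borel (x i) borel (x l)"
    using pairs_indep_two[OF assms, of fst fst] by simp
  then have "F \<Otimes>\<^sub>M F = distr M (borel \<Otimes>\<^sub>M borel) (\<lambda>\<omega>. (x i \<omega>, x l \<omega>))"
    unfolding indep_var_distribution_eq using assms by (simp add: predictor_distr)
  then show ?thesis
    unfolding damped_spread_def by (simp add: integral_distr split_beta)
qed

lemma window_functions_indep:
  assumes n: "n = T * n0"
    and f: "\<And>j. j \<in> {1..T} \<Longrightarrow> f j \<in> borel_measurable (PiM (window n0 j) (\<lambda>_. borel))"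
  shows "indep_vars (\<lambda>_. borel) (\<lambda>j \<omega>. f j (\<lambda>i\<in>window n0 j. (x i \<omega>, y i \<omega>))) {1..T}"
  using window_subset[of _ T n0] n f
  by (intro indep_vars_compose2[OF indep_vars_restrict[OF pairs_indep _ disjoint_windows]]) auto

text \<open>Differences from disjoint windows are independent, and their damped products are
  bounded by one.\<close>

lemma damped_spread_deviation:
  assumes n: "n = T * n0" and n0: "n0 \<ge> 2" and T: "T > 0" and \<delta>: "\<delta> > 0"
  shows "prob {\<omega> \<in> space M. \<bar>(\<Sum>j=1..T. damped_product r s (x ((j - 1) * n0 + 1) \<omega> - x ((j - 1) * n0 + 2) \<omega>))
      - real T * damped_spread F r s\<bar> \<ge> real T * \<delta>} \<le> 1 / (real T * \<delta>\<^sup>2)"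
proof -
  let ?i = "\<lambda>j. (j - 1) * n0 + 1" and ?l = "\<lambda>j. (j - 1) * n0 + 2"
  let ?Z = "\<lambda>j \<omega>. damped_product r s (x (?i j) \<omega> - x (?l j) \<omega>)"
  have win: "?i j \<in> window n0 j" "?l j \<in> window n0 j" if "j \<in> {1..T}" for j
    using window_index[of j 1 n0] window_index[of j 2 n0] n0 that by auto
  have idx: "?i j \<in> {1..n}" "?l j \<in> {1..n}" "?i j \<noteq> ?l j" if "j \<in> {1..T}" for j
    using win[OF that] window_subset[OF that, of n0] n by auto
  note rv [measurable] = predictor_measurable[OF idx(1)] predictor_measurable[OF idx(2)]
  have ind: "indep_vars (\<lambda>_. borel) ?Z {1..T}"
  proof -
    have "indep_vars (\<lambda>_. borel) (\<lambda>j \<omega>. (\<lambda>p. damped_product r s (fst (p (?i j)) - fst (p (?l j))))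
        (\<lambda>i\<in>window n0 j. (x i \<omega>, y i \<omega>))) {1..T}"
    proof (rule window_functions_indep[OF n])
      fix j assume j: "j \<in> {1..T}"
      note [measurable] = measurable_component_singleton[OF win(1)[OF j], of "\<lambda>_. borel"]
        measurable_component_singleton[OF win(2)[OF j], of "\<lambda>_. borel"]
      show "(\<lambda>p. damped_product r s (fst (p (?i j)) - fst (p (?l j))))
          \<in> borel_measurable (PiM (window n0 j) (\<lambda>_. borel :: ((real^'p) \<times> real) measure))"
        by measurable
    qed
    then show ?thesis
      by (rule indep_vars_cong[THEN iffD1, rotated -1]) (use win in auto)
  qed
  have le1: "(damped_product r s d)\<^sup>2 \<le> 1" for d
    using abs_damped_product_le_1[of r s d] by (simp add: abs_square_le_1)
  have "prob {\<omega> \<in> space M. \<bar>(\<Sum>j=1..T. ?Z j \<omega>) - real (card {1..T}) * damped_spread F r s\<bar>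
      \<ge> real (card {1..T}) * \<delta>} \<le> 1 / (real (card {1..T}) * \<delta>\<^sup>2)"
  proof (rule weak_law_bound[OF _ _ ind _ _ _ \<delta>])
    fix j assume j: "j \<in> {1..T}"
    show sq: "integrable M (\<lambda>\<omega>. (?Z j \<omega>)\<^sup>2)"
      using le1 rv[OF j] by (intro integrable_const_bound[of _ 1]) auto
    show "expectation (?Z j) = damped_spread F r s"
      by (rule damped_product_expectation[OF idx[OF j]])
    have "expectation (\<lambda>\<omega>. (?Z j \<omega>)\<^sup>2) \<le> expectation (\<lambda>\<omega>. 1)"
      by (intro integral_mono sq le1) auto
    then show "expectation (\<lambda>\<omega>. (?Z j \<omega>)\<^sup>2) \<le> 1" by (simp add: prob_space)
  qed (use T in auto)
  then show ?thesis by simp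
qed

lemma noise_deviation:
  assumes n: "n = T * n0" and T: "T > 0" and \<delta>: "\<delta> > 0"
    and sq: "integrable F (\<lambda>z. (norm z)\<^sup>2)"
    and g: "\<And>j. j \<in> {1..T} \<Longrightarrow> g j \<in> {1..k} \<and> window n0 j \<subseteq> sample_indices ns (g j)"
    and ab: "a \<in> {1..n0}" "b \<in> {1..n0}"
  shows "prob {\<omega> \<in> space M. \<bar>\<Sum>j=1..T. x ((j - 1) * n0 + a) \<omega> $ r *
      (y ((j - 1) * n0 + b) \<omega> - x ((j - 1) * n0 + b) \<omega> \<bullet> \<beta> - c (g j))\<bar> \<ge> real T * \<delta>}
    \<le> ((\<integral>z. (norm z)\<^sup>2 \<partial>F) * \<sigma>hi\<^sup>2) / (real T * \<delta>\<^sup>2)"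
proof -
  let ?i = "\<lambda>j. (j - 1) * n0 + a" and ?l = "\<lambda>j. (j - 1) * n0 + b"
  let ?Z = "\<lambda>j \<omega>. x (?i j) \<omega> $ r * (y (?l j) \<omega> - x (?l j) \<omega> \<bullet> \<beta> - c (g j))"
  have win: "?i j \<in> window n0 j" "?l j \<in> window n0 j" if "j \<in> {1..T}" for j
    using window_index[of j a n0] window_index[of j b n0] ab that by auto
  have idx: "?i j \<in> {1..n}" "?l j \<in> {1..n}" if "j \<in> {1..T}" for j
    using win[OF that] window_subset[OF that, of n0] n by auto
  have ind: "indep_vars (\<lambda>_. borel) ?Z {1..T}"
  proof -
    have "indep_vars (\<lambda>_. borel) (\<lambda>j \<omega>.
        (\<lambda>p. fst (p (?i j)) $ r * (snd (p (?l j)) - fst (p (?l j)) \<bullet> \<beta> - c (g j)))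
        (\<lambda>i\<in>window n0 j. (x i \<omega>, y i \<omega>))) {1..T}"
    proof (rule window_functions_indep[OF n])
      fix j assume j: "j \<in> {1..T}"
      note [measurable] = measurable_component_singleton[OF win(1)[OF j], of "\<lambda>_. borel"]
        measurable_component_singleton[OF win(2)[OF j], of "\<lambda>_. borel"]
      show "(\<lambda>p. fst (p (?i j)) $ r * (snd (p (?l j)) - fst (p (?l j)) \<bullet> \<beta> - c (g j)))
          \<in> borel_measurable (PiM (window n0 j) (\<lambda>_. borel :: ((real^'p) \<times> real) measure))"
        by measurable
    qed
    then show ?thesis
      by (rule indep_vars_cong[THEN iffD1, rotated -1]) (use win in auto)
  qed
  have "prob {\<omega> \<in> space M. \<bar>(\<Sum>j=1..T. ?Z j \<omega>) - real (card {1..T}) * 0\<bar> \<ge> real (card {1..T}) * \<delta>}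
      \<le> ((\<integral>z. (norm z)\<^sup>2 \<partial>F) * \<sigma>hi\<^sup>2) / (real (card {1..T}) * \<delta>\<^sup>2)"
  proof (rule weak_law_bound[OF _ _ ind _ _ _ \<delta>])
    fix j assume j: "j \<in> {1..T}"
    have s: "g j \<in> {1..k}" "?l j \<in> sample_indices ns (g j)" using g[OF j] win[OF j] by auto
    note m = predictor_residual_moments[OF s idx[OF j] sq, of r]
    show "integrable M (\<lambda>\<omega>. (?Z j \<omega>)\<^sup>2)" "expectation (?Z j) = 0"
      "expectation (\<lambda>\<omega>. (?Z j \<omega>)\<^sup>2) \<le> (\<integral>z. (norm z)\<^sup>2 \<partial>F) * \<sigma>hi\<^sup>2"
      using m by auto
  qed (use T in auto)
  then show ?thesis by simp
qed

text \<open>A union bound over the entries of the damped average and over the offsets and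
  components of the noise sums. The bound is of order \<open>1/T\<close> and depends on the model only
  through quantities that stay fixed along the sequence.\<close>

lemma estimation_error_probability:
  assumes n: "n = T * n0" and n0: "n0 \<ge> 2" and T: "T > 0"
    and dvd: "\<And>s. s \<in> {1..k} \<Longrightarrow> n0 dvd ns s"
    and sq: "integrable F (\<lambda>z. (norm z)\<^sup>2)"
    and \<kappa>: "\<kappa> > 0" and \<delta>: "\<delta> > 0"
    and coercive: "\<And>v::real^'p. (\<Sum>r\<in>UNIV. \<Sum>s\<in>UNIV. v $ r * v $ s * damped_spread F r s) \<ge> \<kappa> * (norm v)\<^sup>2"
    and est: "em_estimator M n0 T x y bhat"
  shows "prob {\<omega> \<in> space M. dist (bhat \<omega>) \<beta> > \<delta>}
    \<le> ((real CARD('p))\<^sup>2 / (\<kappa> / (2 * (real CARD('p))\<^sup>2))\<^sup>2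
      + (real n0)\<^sup>2 * real CARD('p) * ((\<integral>z. (norm z)\<^sup>2 \<partial>F) * \<sigma>hi\<^sup>2)
          / (\<kappa> * \<delta> / (8 * real n0 * real CARD('p)))\<^sup>2) / real T"
proof -
  let ?p = "real CARD('p)"
  define \<delta>1 where "\<delta>1 = \<kappa> / (2 * ?p\<^sup>2)"
  define \<delta>2 where "\<delta>2 = \<kappa> * \<delta> / (8 * real n0 * ?p)"
  define C where "C = (\<integral>z. (norm z)\<^sup>2 \<partial>F) * \<sigma>hi\<^sup>2"
  have pos: "\<delta>1 > 0" "\<delta>2 > 0" using \<kappa> \<delta> n0 by (auto simp: \<delta>1_def \<delta>2_def)
  have "\<exists>s\<in>{1..k}. window n0 j \<subseteq> sample_indices ns s" if "j \<in> {1..T}" for j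
    using window_within_sample[OF dvd _ that] sample_sizes n n0 by auto
  then obtain g where g: "\<And>j. j \<in> {1..T} \<Longrightarrow> g j \<in> {1..k} \<and> window n0 j \<subseteq> sample_indices ns (g j)"
    by metis
  have idx: "(j - 1) * n0 + a \<in> {1..n}" if "j \<in> {1..T}" "a \<in> {1..n0}" for j a
    using window_index[of j a n0] window_subset[of j T n0] that n by auto
  define A where "A = (\<lambda>(r, s). {\<omega> \<in> space M.
     \<bar>(\<Sum>j=1..T. damped_product r s (x ((j - 1) * n0 + 1) \<omega> - x ((j - 1) * n0 + 2) \<omega>))
      - real T * damped_spread F r s\<bar> \<ge> real T * \<delta>1})"
  define B where "B = (\<lambda>(a, b, r). {\<omega> \<in> space M. \<bar>\<Sum>j=1..T. x ((j - 1) * n0 + a) \<omega> $ r *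
      (y ((j - 1) * n0 + b) \<omega> - x ((j - 1) * n0 + b) \<omega> \<bullet> \<beta> - c (g j))\<bar> \<ge> real T * \<delta>2})"
  let ?J = "{1..n0} \<times> {1..n0} \<times> (UNIV :: 'p set)"
  have Am: "A q \<in> events" for q
  proof -
    have "(\<lambda>\<omega>. damped_product (fst q) (snd q) (x ((j - 1) * n0 + 1) \<omega> - x ((j - 1) * n0 + 2) \<omega>))
      \<in> borel_measurable M" if "j \<in> {1..T}" for j
      using predictor_measurable[OF idx[OF that, of 1]] predictor_measurable[OF idx[OF that, of 2]] n0
      by auto
    note [measurable] = this
    show ?thesis unfolding A_def split_beta by measurable
  qed
  have Bm: "B q \<in> events" if "q \<in> ?J" for q
  proof -
    have "(\<lambda>\<omega>. x ((j - 1) * n0 + fst q) \<omega> $ snd (snd q) *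
      (y ((j - 1) * n0 + fst (snd q)) \<omega> - x ((j - 1) * n0 + fst (snd q)) \<omega> \<bullet> \<beta> - c (g j)))
      \<in> borel_measurable M" if j: "j \<in> {1..T}" for j
    proof -
      have "(j - 1) * n0 + fst q \<in> {1..n}" "(j - 1) * n0 + fst (snd q) \<in> {1..n}"
        using idx[OF j] \<open>q \<in> ?J\<close> by (auto simp: mem_Times_iff)
      note [measurable] = this[THEN predictor_measurable] this(2)[THEN response_measurable]
      show ?thesis by measurable
    qed
    note [measurable] = this
    show ?thesis unfolding B_def split_beta by measurable
  qed
  have sub: "{\<omega> \<in> space M. dist (bhat \<omega>) \<beta> > \<delta>} \<subseteq> (\<Union>q\<in>UNIV. A q) \<union> (\<Union>q\<in>?J. B q)"
  proof
    fix \<omega> assume "\<omega> \<in> {\<omega> \<in> space M. dist (bhat \<omega>) \<beta> > \<delta>}"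
    then have \<omega>: "\<omega> \<in> space M" and far: "\<not> norm (bhat \<omega> - \<beta>) \<le> \<delta>" by (auto simp: dist_norm)
    show "\<omega> \<in> (\<Union>q\<in>UNIV. A q) \<union> (\<Union>q\<in>?J. B q)"
    proof (rule ccontr)
      assume not: "\<omega> \<notin> (\<Union>q\<in>UNIV. A q) \<union> (\<Union>q\<in>?J. B q)"
      have A': "\<bar>(\<Sum>j=1..T. damped_product r s (x ((j - 1) * n0 + 1) \<omega> - x ((j - 1) * n0 + 2) \<omega>))
          - real T * damped_spread F r s\<bar> \<le> real T * \<delta>1" for r s
      proof -
        have "\<omega> \<notin> A (r, s)" using not by blast
        then show ?thesis using \<omega> by (simp add: A_def)
      qed
      (* (i - 1) div n0 + 1 is the number of the window that contains i. *)
      define e where "e i = y i \<omega> - x i \<omega> \<bullet> \<beta> - c (g ((i - 1) div n0 + 1))" for i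
      have win: "(i - 1) div n0 + 1 = j" if "j \<in> {1..T}" "i \<in> window n0 j" for i j
      proof -
        have "(j - 1) * n0 \<le> i - 1" "i - 1 < Suc (j - 1) * n0"
          using that n0 by (auto simp: window_def)
        then have "(i - 1) div n0 = j - 1" using div_nat_eqI[of n0 "j - 1" "i - 1"] by (simp add: mult.commute)
        then show ?thesis using that by simp
      qed
      have B': "\<bar>\<Sum>j=1..T. x ((j - 1) * n0 + a) \<omega> $ r * e ((j - 1) * n0 + b)\<bar> \<le> real T * \<delta>2"
        if "a \<in> {1..n0}" "b \<in> {1..n0}" for a b r
      proof -
        have "\<omega> \<notin> B (a, b, r)" using not that by blast
        moreover have "e ((j - 1) * n0 + b) = y ((j - 1) * n0 + b) \<omega> - x ((j - 1) * n0 + b) \<omega> \<bullet> \<beta> - c (g j)"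
          if "j \<in> {1..T}" for j
          unfolding e_def using win[OF that window_index[of j b n0]] that \<open>b \<in> {1..n0}\<close> by simp
        ultimately show ?thesis using \<omega> by (simp add: B_def)
      qed
      have "norm (bhat \<omega> - \<beta>) \<le> \<delta>"
      proof (rule estimation_error_le[OF n0 T \<kappa> \<delta> coercive])
        show "y i \<omega> = x i \<omega> \<bullet> \<beta> + c (g j) + e i" if "j \<in> {1..T}" "i \<in> window n0 j" for i j
          unfolding e_def win[OF that] by simp
        show "em_solution n0 T (\<lambda>i. x i \<omega>) (\<lambda>i. y i \<omega>) (bhat \<omega>)"
          if "invertible (within_window_scatter n0 T (\<lambda>i. x i \<omega>))"
          using est \<omega> that by (auto simp: em_estimator_def)
      qed (use A' B' in \<open>auto simp: \<delta>1_def \<delta>2_def\<close>)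
      then show False using far by simp
    qed
  qed
  have "prob {\<omega> \<in> space M. dist (bhat \<omega>) \<beta> > \<delta>} \<le> prob ((\<Union>q\<in>UNIV. A q) \<union> (\<Union>q\<in>?J. B q))"
    using Am Bm by (intro finite_measure_mono[OF sub] sets.Un sets.finite_UN) auto
  also have "\<dots> \<le> prob (\<Union>q\<in>UNIV. A q) + prob (\<Union>q\<in>?J. B q)"
    using Am Bm by (intro measure_Un_le sets.finite_UN) auto
  also have "\<dots> \<le> (\<Sum>q\<in>UNIV. prob (A q)) + (\<Sum>q\<in>?J. prob (B q))"
    using Am Bm by (intro add_mono finite_measure_subadditive_finite) auto
  also have "\<dots> \<le> (\<Sum>q\<in>(UNIV :: ('p \<times> 'p) set). 1 / (real T * \<delta>1\<^sup>2)) + (\<Sum>q\<in>?J. C / (real T * \<delta>2\<^sup>2))"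
  proof (intro add_mono sum_mono)
    show "prob (A q) \<le> 1 / (real T * \<delta>1\<^sup>2)" for q
      unfolding A_def split_beta by (rule damped_spread_deviation[OF n n0 T pos(1)])
    show "prob (B q) \<le> C / (real T * \<delta>2\<^sup>2)" if "q \<in> ?J" for q
      unfolding B_def split_beta C_def using that
      by (intro noise_deviation[OF n T pos(2) sq g]) auto
  qed
  also have "\<dots> = (?p\<^sup>2 / \<delta>1\<^sup>2 + (real n0)\<^sup>2 * ?p * C / \<delta>2\<^sup>2) / real T"
    by (simp add: power2_eq_square add_divide_distrib card_cartesian_product mult_ac flip: UNIV_Times_UNIV)
  finally show ?thesis unfolding \<delta>1_def \<delta>2_def C_def .
qed

end

section \<open>Consistency\<close>

theorem theorem2:
  fixes n0 :: nat
    and T k :: "nat \<Rightarrow> nat"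
    and M :: "nat \<Rightarrow> 'a measure"
    and ns :: "nat \<Rightarrow> nat \<Rightarrow> nat"
    and c \<sigma> :: "nat \<Rightarrow> nat \<Rightarrow> real"
    and \<mu>lo \<mu>hi \<sigma>lo \<sigma>hi :: real
    and F :: "(real^'p) measure"
    and \<beta> :: "real^'p"
    and x :: "nat \<Rightarrow> nat \<Rightarrow> 'a \<Rightarrow> real^'p"
    and \<nu> \<epsilon> y :: "nat \<Rightarrow> nat \<Rightarrow> 'a \<Rightarrow> real"
    and bhat :: "nat \<Rightarrow> 'a \<Rightarrow> real^'p"
  assumes n0: "n0 \<ge> 2"
    and T: "filterlim T at_top sequentially"
    and model: "\<And>m. k_sample_regression (M m) (T m * n0) (k m) (ns m) (c m) (\<sigma> m)
                  \<mu>lo \<mu>hi \<sigma>lo \<sigma>hi F \<beta> (x m) (\<nu> m) (\<epsilon> m) (y m)"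
    and window_size: "\<And>m. n0 < Min (ns m ` {1..k m})"
    and window_dvd: "\<And>m j. j \<in> {1..k m} \<Longrightarrow> n0 dvd ns m j"
    and x_indep: "\<And>m. prob_space.indep_vars (M m) (\<lambda>_. borel) (x m) {1..T m * n0}"
    and third_moment: "integrable F (\<lambda>z. norm z ^ 3)"
    and pos_def: "positive_definite (covariance_matrix F)"
    and estimator: "\<And>m. em_estimator (M m) n0 (T m) (x m) (y m) (bhat m)"
  shows "converges_in_probability M bhat \<beta>"
proof -
  have T_pos: "eventually (\<lambda>m. T m > 0) sequentially"
    using T by (rule eventually_compose_filterlim[OF eventually_gt_at_top])
  then obtain m where "T m > 0" by (auto simp: eventually_sequentially)
  then have one: "1 \<in> {1..T m * n0}" using n0 by (simp add: Suc_le_eq)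
  interpret m: k_sample_regression "M m" "T m * n0" "k m" "ns m" "c m" "\<sigma> m"
      \<mu>lo \<mu>hi \<sigma>lo \<sigma>hi F \<beta> "x m" "\<nu> m" "\<epsilon> m" "y m" by (rule model)
  have F: "prob_space F" "sets F = sets borel"
    using m.prob_space_distr[OF m.predictor_measurable[OF one]] m.predictor_distr[OF one]
    by (metis, metis sets_distr)
  interpret F: prob_space F by fact
  have [measurable_cong]: "sets F = sets borel" by fact
  have sq: "integrable F (\<lambda>z. (norm z)\<^sup>2)"
  proof (rule Bochner_Integration.integrable_bound)
    show "integrable F (\<lambda>z. 1 + norm z ^ 3)" using third_moment by simp
    have "t\<^sup>2 \<le> 1 + t ^ 3" if "t \<ge> 0" for t :: real
    proof (cases "t \<le> 1")
      case True
      then show ?thesis using that power_le_one[of t 2] zero_le_power[of t 3] by linarith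
    next
      case False
      then show ?thesis using power_increasing[of 2 3 t] by linarith
    qed
    then show "AE z in F. norm ((norm z)\<^sup>2) \<le> norm (1 + norm z ^ 3)" by auto
  qed simp
  obtain \<kappa> where \<kappa>: "\<kappa> > 0"
    "\<And>v::real^'p. (\<Sum>r\<in>UNIV. \<Sum>s\<in>UNIV. v $ r * v $ s * damped_spread F r s) \<ge> \<kappa> * (norm v)\<^sup>2"
    using positive_quadratic_form_coercive[OF damped_spread_positive[OF F sq pos_def]] by blast
  show ?thesis
    unfolding converges_in_probability_def
  proof (intro allI impI)
    fix \<delta> :: real assume \<delta>: "\<delta> > 0"
    obtain K where K: "\<And>m. T m > 0 \<Longrightarrow>
        measure (M m) {\<omega> \<in> space (M m). dist (bhat m \<omega>) \<beta> > \<delta>} \<le> K / real (T m)"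
      using k_sample_regression.estimation_error_probability[OF model refl n0 _ window_dvd sq \<kappa>(1) \<delta> \<kappa>(2) estimator]
      by blast
    have "filterlim (\<lambda>m. real (T m)) at_top sequentially"
      by (rule filterlim_compose[OF filterlim_real_sequentially T])
    then have "(\<lambda>m. K / real (T m)) \<longlonglongrightarrow> 0"
      by (rule tendsto_divide_0[OF tendsto_const filterlim_at_top_imp_at_infinity])
    then show "(\<lambda>m. measure (M m) {\<omega> \<in> space (M m). dist (bhat m \<omega>) \<beta> > \<delta>}) \<longlonglongrightarrow> 0"
      by (rule tendsto_sandwich[OF _ _ tendsto_const, rotated 2])
         (use T_pos K in \<open>auto elim: eventually_mono\<close>)
  qed
qed

end
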